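(* Let $\kappa>0$ and let $u:\mathbb R\to\mathbb R$ be a bounded solution of $$\kappa^2u''+\sin u=0,\quad x\in\mathbb R,$$ with $|u(0)|\le\pi$, and let $C\ge-1$ be the constant such that $$\tfrac12\kappa^2(u')^2=C+\cos u\quad\text{on }\mathbb R.$$ Then the following hold. (1) For $C>1$, there does not exist any bounded solution. (2) If $C=-1$, then $u\equiv0$. (3) If $C=1$, then either $u(x)=2\arcsin\tanh\left(\frac{x}{\kappa}+c\right)$ for some constant $c\in\mathbb R$, or $u(x)=-2\arcsin\tanh\left(\frac{x}{\kappa}+c\right)$ for some constant $c\in\mathbb R$, or $u\equiv\pi$, or $u\equiv-\pi$. (4) If $-1<C<1$, then $u$ is a periodic function and $\|u\|_\infty<\pi$.
   Context: Solutions are classical ($C^2$) solutions on $\mathbb R$. The constant $C$ is well defined for any solution: multiplying the equation by $u'$ and integrating shows that $\frac12\kappa^2(u')^2-\cos u$ is constant on $\mathbb R$, and this constant is called $C$; necessarily $C\ge-1$. $\|u\|_\infty=\sup_{x\in\mathbb R}|u(x)|$. *)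

theory Defs
  imports "HOL-Analysis.Analysis"
begin

definition C2_on_reals :: "(real \<Rightarrow> real) \<Rightarrow> bool" where
  "C2_on_reals u \<longleftrightarrow>
     u differentiable_on UNIV \<and>
     deriv u differentiable_on UNIV \<and>
     continuous_on UNIV (deriv (deriv u))"

definition pendulum_solution :: "real \<Rightarrow> (real \<Rightarrow> real) \<Rightarrow> bool" where
  "pendulum_solution \<kappa> u \<longleftrightarrow>
     C2_on_reals u \<and> (\<forall>x. \<kappa>\<^sup>2 * deriv (deriv u) x + sin (u x) = 0)"

(* Every solution has exactly one such C, because (1/2) \<kappa>^2 (u')^2 - cos u has derivative 0;
   the relation names that constant. *)
definition first_integral_const :: "real \<Rightarrow> (real \<Rightarrow> real) \<Rightarrow> real \<Rightarrow> bool" where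
  "first_integral_const \<kappa> u C \<longleftrightarrow> (\<forall>x. 1/2 * \<kappa>\<^sup>2 * (deriv u x)\<^sup>2 = C + cos (u x))"

(* For unbounded u the real-valued supremum is meaningless; use only for bounded functions. *)
definition sup_norm :: "(real \<Rightarrow> real) \<Rightarrow> real" where
  "sup_norm u = (SUP x. \<bar>u x\<bar>)"

(* The library locale also admits the period 0, hence the condition T > 0. *)
definition periodic :: "(real \<Rightarrow> real) \<Rightarrow> bool" where
  "periodic u \<longleftrightarrow> (\<exists>T>0. periodic_fun_simple u T)"

end

theory Submission
  imports Defs
begin

text \<open>
  The proof treats the pendulum equation as a first-order system for the pair of \<open>u\<close> and its
  velocity \<open>w = u'\<close>, and rests on three elementary facts.

  Uniqueness (\<open>pendulum_flow_unique\<close>): for two solutions, the quantity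
  \<open>E = (u\<^sub>1 - u\<^sub>2)\<^sup>2 + \<kappa>\<^sup>2 (w\<^sub>1 - w\<^sub>2)\<^sup>2\<close> satisfies \<open>\<bar>E'\<bar> \<le> (2/\<kappa>) E\<close> because the sine is
  1-Lipschitz, so it vanishes identically as soon as it vanishes once.  Symmetry: if \<open>(u, w)\<close> is a
  solution, then so are its negative and its reflection in any point of the line.  Growth
  (\<open>slope_bounded_below_imp_unbounded\<close>): a function whose slope stays above a positive constant on
  a half-line is not bounded above there.

  For \<open>C > 1\<close> the velocity is bounded away from \<open>0\<close> and therefore has constant sign, so growth
  forces \<open>u\<close> to be unbounded.  For \<open>C = -1\<close> the first integral leaves only \<open>w = 0\<close> and
  \<open>cos u = 1\<close>.  For \<open>C = 1\<close> the explicit kink \<open>2 arcsin (tanh (x/\<kappa> + c))\<close> is a solution; the first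
  integral fixes the velocity at the origin up to sign once \<open>u 0\<close> is known, so \<open>c\<close> can be chosen to
  match both initial data, and uniqueness identifies \<open>u\<close> with the kink, its negative, or, when
  \<open>w 0 = 0\<close>, an equilibrium.

  For \<open>-1 < C < 1\<close> the first integral gives \<open>cos u \<ge> -C > -1\<close>, so by continuity
  \<open>\<bar>u\<bar> \<le> arccos (-C) < pi\<close>.  A solution trapped in this way has velocity zeros arbitrarily far to the
  right (\<open>trapped_velocity_has_zero\<close>).  Otherwise \<open>u\<close> or \<open>-u\<close> would increase forever: staying
  nonpositive it would be convex with slope bounded below, contradicting boundedness, and once positive
  it would decelerate at a uniform rate, so that the velocity would change sign after all.  At a zero of
  the velocity \<open>u\<close> agrees to first order with its reflection, hence is symmetric about it, and two
  distinct centres of symmetry \<open>a < b\<close> make \<open>u\<close> periodic with period \<open>2 (b - a)\<close>.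
\<close>

section \<open>Growth and comparison on the line\<close>

lemma slope_bounded_below_imp_unbounded:
  fixes f f' :: "real \<Rightarrow> real"
  assumes deriv: "\<And>x. a \<le> x \<Longrightarrow> (f has_real_derivative f' x) (at x)"
    and slope: "\<And>x. a \<le> x \<Longrightarrow> m \<le> f' x" and "m > 0"
  shows "\<exists>x\<ge>a. f x > B"
proof -
  define x where "x = a + (\<bar>B - f a\<bar> + 1) / m"
  have "a < x"
    using \<open>m > 0\<close> by (simp add: x_def)
  then obtain z where z: "a < z" "z < x" "f x - f a = (x - a) * f' z"
    using MVT2[of a x f f'] deriv by auto
  have "(x - a) * m \<le> (x - a) * f' z"
    using slope z \<open>a < x\<close> by (intro mult_left_mono) auto
  moreover have "(x - a) * m = \<bar>B - f a\<bar> + 1"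
    using \<open>m > 0\<close> by (simp add: x_def)
  ultimately show ?thesis
    using z(3) \<open>a < x\<close> by (intro exI[of _ x]) auto
qed

lemma nonvanishing_imp_constant_sign:
  fixes f :: "real \<Rightarrow> real"
  assumes "continuous_on {a..} f" and nz: "\<And>x. a \<le> x \<Longrightarrow> f x \<noteq> 0"
  shows "(\<forall>x\<ge>a. f x > 0) \<or> (\<forall>x\<ge>a. f x < 0)"
proof (rule ccontr)
  assume "\<not> ?thesis"
  then obtain p q where pq: "a \<le> p" "f p \<le> 0" "a \<le> q" "f q \<ge> 0"
    by (meson not_less)
  have "connected (f ` {a..})"
    using assms(1) by (intro connected_continuous_image) auto
  then have "0 \<in> f ` {a..}"
    by (rule connectedD_interval[of _ "f p" "f q"]) (use pq in auto)
  with nz show False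
    by auto
qed

text \<open>Gronwall's inequality in both time directions: the factors \<open>exp (-K x)\<close> and \<open>exp (K x)\<close> turn
  the differential inequality into monotonicity.\<close>

lemma gronwall_zero:
  fixes E E' :: "real \<Rightarrow> real"
  assumes deriv: "\<And>x. (E has_real_derivative E' x) (at x)"
    and bound: "\<And>x. \<bar>E' x\<bar> \<le> K * E x"
    and nonneg: "\<And>x. 0 \<le> E x" and zero: "E a = 0"
  shows "E x = 0"
proof (cases "a \<le> x")
  case True
  have "E x * exp (- K * x) \<le> E a * exp (- K * a)"
  proof (rule DERIV_nonpos_imp_nonincreasing[OF True])
    fix t
    have "((\<lambda>t. E t * exp (- K * t)) has_real_derivative (E' t - K * E t) * exp (- K * t)) (at t)"
      by (auto intro!: derivative_eq_intros deriv simp: algebra_simps)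
    moreover have "(E' t - K * E t) * exp (- K * t) \<le> 0"
      using bound[of t] by (intro mult_nonpos_nonneg) auto
    ultimately show "\<exists>y. ((\<lambda>t. E t * exp (- K * t)) has_real_derivative y) (at t) \<and> y \<le> 0"
      by blast
  qed
  with zero nonneg[of x] show ?thesis
    by (auto simp: mult_le_0_iff)
next
  case False
  then have "x \<le> a" by simp
  have "E x * exp (K * x) \<le> E a * exp (K * a)"
  proof (rule DERIV_nonneg_imp_nondecreasing[OF \<open>x \<le> a\<close>])
    fix t
    have "((\<lambda>t. E t * exp (K * t)) has_real_derivative (E' t + K * E t) * exp (K * t)) (at t)"
      by (auto intro!: derivative_eq_intros deriv simp: algebra_simps)
    moreover have "(E' t + K * E t) * exp (K * t) \<ge> 0"
      using bound[of t] by (intro mult_nonneg_nonneg) auto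
    ultimately show "\<exists>y. ((\<lambda>t. E t * exp (K * t)) has_real_derivative y) (at t) \<and> y \<ge> 0"
      by blast
  qed
  with zero nonneg[of x] show ?thesis
    by (auto simp: mult_le_0_iff)
qed

lemma abs_sin_diff_le:
  fixes x y :: real
  shows "\<bar>sin x - sin y\<bar> \<le> \<bar>x - y\<bar>"
proof -
  have "\<bar>sin x - sin y\<bar> = 2 * \<bar>sin ((x - y) / 2)\<bar> * \<bar>cos ((x + y) / 2)\<bar>"
    by (simp add: sin_diff_sin abs_mult)
  also have "\<dots> \<le> 2 * \<bar>(x - y) / 2\<bar> * 1"
    by (intro mult_mono abs_sin_x_le_abs_x) auto
  finally show ?thesis by simp
qed

section \<open>The pendulum system\<close>

definition pendulum_flow :: "real \<Rightarrow> (real \<Rightarrow> real) \<Rightarrow> (real \<Rightarrow> real) \<Rightarrow> bool" where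
  "pendulum_flow \<kappa> u w \<longleftrightarrow>
     (\<forall>x. (u has_real_derivative w x) (at x)) \<and>
     (\<forall>x. (w has_real_derivative - sin (u x) / \<kappa>\<^sup>2) (at x))"

lemma pendulum_flowD:
  assumes "pendulum_flow \<kappa> u w"
  shows "(u has_real_derivative w x) (at x)"
    and "(w has_real_derivative - sin (u x) / \<kappa>\<^sup>2) (at x)"
  using assms by (auto simp: pendulum_flow_def)

lemma pendulum_flow_continuous:
  assumes "pendulum_flow \<kappa> u w"
  shows "continuous_on S u" and "continuous_on S w"
  using pendulum_flowD[OF assms] by (meson DERIV_isCont continuous_at_imp_continuous_on)+

lemma pendulum_solution_imp_flow:
  assumes "pendulum_solution \<kappa> u" and "\<kappa> > 0"
  shows "pendulum_flow \<kappa> u (deriv u)"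
proof -
  have "u differentiable at x" "deriv u differentiable at x" for x
    using assms(1) by (auto simp: pendulum_solution_def C2_on_reals_def differentiable_on_def)
  then have "(u has_real_derivative deriv u x) (at x)"
    "(deriv u has_real_derivative deriv (deriv u) x) (at x)" for x
    by (simp_all add: DERIV_deriv_iff_real_differentiable)
  moreover have "deriv (deriv u) x = - sin (u x) / \<kappa>\<^sup>2" for x
  proof -
    have "\<kappa>\<^sup>2 * deriv (deriv u) x + sin (u x) = 0"
      using assms(1) by (simp add: pendulum_solution_def)
    then have "\<kappa>\<^sup>2 * deriv (deriv u) x = - sin (u x)"
      by linarith
    with \<open>\<kappa> > 0\<close> show ?thesis
      by (metis mult.commute nonzero_eq_divide_eq order_less_irrefl zero_less_power)
  qed
  ultimately show ?thesis
    by (simp add: pendulum_flow_def)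
qed

lemma pendulum_flow_minus:
  assumes "pendulum_flow \<kappa> u w"
  shows "pendulum_flow \<kappa> (\<lambda>x. - u x) (\<lambda>x. - w x)"
  unfolding pendulum_flow_def
  by (auto intro!: derivative_eq_intros pendulum_flowD[OF assms])

lemma pendulum_flow_reflect:
  assumes "pendulum_flow \<kappa> u w"
  shows "pendulum_flow \<kappa> (\<lambda>x. u (2 * a - x)) (\<lambda>x. - w (2 * a - x))"
proof -
  have "((\<lambda>x. 2 * a - x) has_real_derivative -1) (at x)" for x
    by (auto intro!: derivative_eq_intros)
  from DERIV_chain2[OF pendulum_flowD(1)[OF assms] this]
    DERIV_chain2[OF pendulum_flowD(2)[OF assms] this, THEN DERIV_minus]
  show ?thesis
    by (simp add: pendulum_flow_def)
qed

lemma pendulum_flow_unique: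
  assumes u: "pendulum_flow \<kappa> u w" and v: "pendulum_flow \<kappa> v z" and "\<kappa> > 0"
    and init: "u a = v a" "w a = z a"
  shows "u x = v x"
proof -
  define E where "E x = (u x - v x)\<^sup>2 + \<kappa>\<^sup>2 * (w x - z x)\<^sup>2" for x
  define E' where "E' x = 2 * (w x - z x) * ((u x - v x) - (sin (u x) - sin (v x)))" for x
  have "E x = 0"
  proof (rule gronwall_zero[of E E' "2 / \<kappa>" a])
    fix x
    show "(E has_real_derivative E' x) (at x)"
    proof -
      define p q where "p = - sin (u x) / \<kappa>\<^sup>2" and "q = - sin (v x) / \<kappa>\<^sup>2"
      have "(w has_real_derivative p) (at x)" "(z has_real_derivative q) (at x)"
        unfolding p_def q_def by (rule pendulum_flowD[OF u] pendulum_flowD[OF v])+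
      then have "(E has_real_derivative
          2 * (u x - v x) * (w x - z x) + \<kappa>\<^sup>2 * (2 * (w x - z x) * (p - q))) (at x)"
        unfolding E_def[abs_def]
        by (auto intro!: derivative_eq_intros pendulum_flowD(1)[OF u] pendulum_flowD(1)[OF v]
            simp: algebra_simps)
      also have "2 * (u x - v x) * (w x - z x) + \<kappa>\<^sup>2 * (2 * (w x - z x) * (p - q)) =
          2 * (w x - z x) * ((u x - v x) + (\<kappa>\<^sup>2 * p - \<kappa>\<^sup>2 * q))"
        by (simp add: algebra_simps)
      also have "\<dots> = E' x"
        using \<open>\<kappa> > 0\<close> by (simp add: E'_def p_def q_def)
      finally show ?thesis .
    qed
    have "\<bar>sin (u x) - sin (v x)\<bar> \<le> \<bar>u x - v x\<bar>"
      by (rule abs_sin_diff_le)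
    then have "\<bar>(u x - v x) - (sin (u x) - sin (v x))\<bar> \<le> 2 * \<bar>u x - v x\<bar>"
      by (intro order.trans[OF abs_triangle_ineq4]) simp
    then have "\<bar>E' x\<bar> \<le> 2 * \<bar>w x - z x\<bar> * (2 * \<bar>u x - v x\<bar>)"
      unfolding E'_def abs_mult by (intro mult_mono) auto
    also have "\<dots> \<le> 2 / \<kappa> * E x"
    proof -
      \<comment> \<open>The weight \<open>\<kappa>\<^sup>2\<close> in \<open>E\<close> makes this square produce the product in the bound for \<open>E'\<close>.\<close>
      have "0 \<le> (\<bar>u x - v x\<bar> - \<kappa> * \<bar>w x - z x\<bar>)\<^sup>2"
        by simp
      also have "\<dots> = E x - 2 * \<kappa> * \<bar>w x - z x\<bar> * \<bar>u x - v x\<bar>"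
        by (simp add: E_def power2_diff power_mult_distrib)
      finally show ?thesis
        using \<open>\<kappa> > 0\<close> by (simp add: field_simps)
    qed
    finally show "\<bar>E' x\<bar> \<le> 2 / \<kappa> * E x" .
    show "0 \<le> E x"
      by (simp add: E_def)
  next
    show "E a = 0"
      by (simp add: E_def init)
  qed
  then show ?thesis
    by (simp add: E_def add_nonneg_eq_0_iff)
qed

text \<open>Reversing time about \<open>a\<close> keeps the angle at \<open>a\<close> and negates the velocity there, so at a point of
  rest the reflected solution has the same data.\<close>

lemma pendulum_flow_symmetric_about_rest:
  assumes "pendulum_flow \<kappa> u w" and "\<kappa> > 0" and "w a = 0"
  shows "u (2 * a - x) = u x"
proof (rule pendulum_flow_unique[OF pendulum_flow_reflect[OF assms(1)] assms(1,2)])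
  show "u (2 * a - a) = u a" "- w (2 * a - a) = w a"
    using assms(3) by simp_all
qed

section \<open>Rotation\<close>

text \<open>Above the separatrix level the speed has a positive lower bound, and the velocity cannot change
  sign.\<close>

lemma rotation_unbounded:
  assumes u: "pendulum_flow \<kappa> u w" and "\<kappa> > 0" and "C > 1"
    and energy: "\<And>x. 1/2 * \<kappa>\<^sup>2 * (w x)\<^sup>2 = C + cos (u x)"
  shows "\<not> bounded (range u)"
proof
  assume "bounded (range u)"
  then obtain B where B: "\<bar>u x\<bar> \<le> B" for x
    by (auto simp: bounded_iff)
  define m where "m = sqrt (2 * (C - 1)) / \<kappa>"
  have "m > 0"
    using assms by (simp add: m_def)
  have speed: "m \<le> \<bar>w x\<bar>" for x
  proof -
    have "m\<^sup>2 = 2 * (C - 1) / \<kappa>\<^sup>2"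
      using assms by (simp add: m_def power_divide)
    also have "\<dots> \<le> (w x)\<^sup>2"
    proof -
      have "2 * (C - 1) \<le> (w x)\<^sup>2 * \<kappa>\<^sup>2"
        using energy[of x] cos_ge_minus_one[of "u x"] by (simp add: mult.commute)
      then show ?thesis
        using \<open>\<kappa> > 0\<close> by (simp add: pos_divide_le_eq)
    qed
    finally show ?thesis
      using \<open>m > 0\<close> by (simp add: abs_le_square_iff[symmetric])
  qed
  then have "w x \<noteq> 0" for x
    using \<open>m > 0\<close> by (metis abs_zero not_less)
  then consider "\<forall>x\<ge>0. w x > 0" | "\<forall>x\<ge>0. w x < 0"
    using nonvanishing_imp_constant_sign[of 0 w] pendulum_flow_continuous[OF u] by blast
  then show False
  proof cases
    case 1
    with speed have "m \<le> w x" if "0 \<le> x" for x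
      using that by (metis abs_of_pos)
    then obtain x where "u x > B"
      using slope_bounded_below_imp_unbounded[OF pendulum_flowD(1)[OF u] _ \<open>m > 0\<close>] by blast
    with B[of x] show False by simp
  next
    case 2
    with speed have "m \<le> - w x" if "0 \<le> x" for x
      using that by (metis abs_of_neg)
    then obtain x where "- u x > B"
      using slope_bounded_below_imp_unbounded
        [OF pendulum_flowD(1)[OF pendulum_flow_minus[OF u]] _ \<open>m > 0\<close>] by blast
    with B[of x] show False by simp
  qed
qed

section \<open>The separatrix\<close>

lemma tanh_artanh_real:
  fixes x :: real
  assumes "\<bar>x\<bar> < 1"
  shows "tanh (artanh x) = x"
proof -
  have "(1 + x) / (1 - x) > 0"
    using assms by auto
  then have "exp (- 2 * artanh x) = inverse ((1 + x) / (1 - x))"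
    by (simp add: artanh_def exp_minus)
  also have "\<dots> = (1 - x) / (1 + x)"
    by simp
  finally have exp_eq: "exp (- 2 * artanh x) = (1 - x) / (1 + x)" .
  have "1 + x \<noteq> 0"
    using assms by auto
  then have "1 - (1 - x) / (1 + x) = 2 * x / (1 + x)" "1 + (1 - x) / (1 + x) = 2 / (1 + x)"
    by (simp_all add: field_simps)
  with \<open>1 + x \<noteq> 0\<close> show ?thesis
    unfolding tanh_real_altdef exp_eq by simp
qed

lemma kink_pendulum_flow:
  assumes "\<kappa> > 0"
  shows "pendulum_flow \<kappa> (\<lambda>x. 2 * arcsin (tanh (x / \<kappa> + c))) (\<lambda>x. 2 / (\<kappa> * cosh (x / \<kappa> + c)))"
proof -
  have cos_tanh: "sqrt (1 - (tanh y)\<^sup>2) = 1 / cosh y" for y :: real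
  proof -
    have "1 - (tanh y)\<^sup>2 = (1 / cosh y)\<^sup>2"
      using hyperbolic_pythagoras[of y] cosh_real_pos[of y]
      by (simp add: tanh_def power_divide diff_divide_eq_iff less_imp_neq[symmetric])
    then show ?thesis
      using cosh_real_pos[of y] by simp
  qed
  have sin_arc: "sin (2 * arcsin (tanh y)) = 2 * tanh y / cosh y" for y :: real
    using tanh_real_bounds[of y]
    by (simp add: sin_double cos_arcsin cos_tanh)
  have "((\<lambda>x. 2 * arcsin (tanh (x / \<kappa> + c))) has_real_derivative 2 / (\<kappa> * cosh (x / \<kappa> + c))) (at x)"
    for x
  proof -
    define y where "y = x / \<kappa> + c"
    have "((\<lambda>x. tanh (x / \<kappa> + c)) has_real_derivative (1 / cosh y)\<^sup>2 / \<kappa>) (at x)"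
      using \<open>\<kappa> > 0\<close> cos_tanh[of y, symmetric] tanh_real_bounds[of y]
      by (auto intro!: derivative_eq_intros simp: y_def abs_square_le_1 less_imp_le)
    from DERIV_arcsin[THEN DERIV_chain2, OF _ _ this] tanh_real_bounds[of y]
    have "((\<lambda>x. arcsin (tanh (x / \<kappa> + c))) has_real_derivative
      inverse (sqrt (1 - (tanh y)\<^sup>2)) * ((1 / cosh y)\<^sup>2 / \<kappa>)) (at x)"
      by (simp add: y_def)
    then have "((\<lambda>x. 2 * arcsin (tanh (x / \<kappa> + c))) has_real_derivative
      2 * (inverse (sqrt (1 - (tanh y)\<^sup>2)) * ((1 / cosh y)\<^sup>2 / \<kappa>))) (at x)"
      by (rule DERIV_cmult)
    also have "2 * (inverse (sqrt (1 - (tanh y)\<^sup>2)) * ((1 / cosh y)\<^sup>2 / \<kappa>)) = 2 / (\<kappa> * cosh y)"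
      unfolding cos_tanh by (simp add: power2_eq_square)
    finally show ?thesis
      by (simp add: y_def)
  qed
  moreover have "((\<lambda>x. 2 / (\<kappa> * cosh (x / \<kappa> + c))) has_real_derivative
      - sin (2 * arcsin (tanh (x / \<kappa> + c))) / \<kappa>\<^sup>2) (at x)" for x
  proof -
    define y where "y = x / \<kappa> + c"
    have "((\<lambda>x. 2 / (\<kappa> * cosh (x / \<kappa> + c))) has_real_derivative
        - (2 * (\<kappa> * (sinh y / \<kappa>))) / (\<kappa> * cosh y)\<^sup>2) (at x)"
      using \<open>\<kappa> > 0\<close>
      by (auto intro!: derivative_eq_intros simp: y_def power2_eq_square)
    also have "- (2 * (\<kappa> * (sinh y / \<kappa>))) / (\<kappa> * cosh y)\<^sup>2 =
        - sin (2 * arcsin (tanh y)) / \<kappa>\<^sup>2"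
      unfolding sin_arc using \<open>\<kappa> > 0\<close> by (simp add: tanh_def power2_eq_square)
    finally show ?thesis
      by (simp add: y_def)
  qed
  ultimately show ?thesis
    by (simp add: pendulum_flow_def)
qed

text \<open>On the separatrix \<open>(\<kappa> w)\<^sup>2 = 2 (1 + cos u) = (2 cos (u/2))\<^sup>2\<close>, so the initial speed is
  \<open>2 cos (u 0 / 2) / \<kappa>\<close>.  The kink attains the initial angle when \<open>tanh c = sin (u 0 / 2)\<close>,
  and then \<open>cosh c = 1 / cos (u 0 / 2)\<close>, so that its speed at the origin is the same.\<close>

lemma separatrix_increasing:
  assumes u: "pendulum_flow \<kappa> u w" and "\<kappa> > 0"
    and energy: "1/2 * \<kappa>\<^sup>2 * (w 0)\<^sup>2 = 1 + cos (u 0)"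
    and "w 0 > 0" and "\<bar>u 0\<bar> \<le> pi"
  shows "\<exists>c. \<forall>x. u x = 2 * arcsin (tanh (x / \<kappa> + c))"
proof -
  define h where "h = u 0 / 2"
  have speed: "(\<kappa> * w 0)\<^sup>2 = (2 * cos h)\<^sup>2"
    using energy cos_double_cos[of h] by (simp add: h_def power_mult_distrib)
  moreover have "\<kappa> * w 0 > 0"
    using assms by simp
  moreover have "cos h \<ge> 0"
    using \<open>\<bar>u 0\<bar> \<le> pi\<close> by (intro cos_ge_zero) (auto simp: h_def)
  ultimately have w0: "\<kappa> * w 0 = 2 * cos h" and "cos h > 0"
    by (auto simp only: power2_eq_iff)
  have "(sin h)\<^sup>2 < 1"
    using \<open>cos h > 0\<close> sin_cos_squared_add[of h] by (smt (verit) zero_less_power)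
  then have "\<bar>sin h\<bar> < 1"
    by (simp add: abs_square_less_1)
  then have tanh_c: "tanh (artanh (sin h)) = sin h"
    by (rule tanh_artanh_real)
  have cosh_c: "cos h * cosh (artanh (sin h)) = 1"
  proof -
    define c where "c = artanh (sin h)"
    have "sinh c = sin h * cosh c"
      using tanh_c cosh_real_pos[of c] by (simp add: c_def tanh_def field_simps)
    then have "(cos h * cosh c)\<^sup>2 = 1"
      using cosh_square_eq[of c] by (simp add: cos_squared_eq power_mult_distrib algebra_simps)
    moreover have "cos h * cosh c > 0"
      using \<open>cos h > 0\<close> by simp
    ultimately show ?thesis
      by (auto simp: c_def power2_eq_1_iff)
  qed
  have "u x = 2 * arcsin (tanh (x / \<kappa> + artanh (sin h)))" for x
  proof (rule pendulum_flow_unique[OF u kink_pendulum_flow])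
    show "u 0 = 2 * arcsin (tanh (0 / \<kappa> + artanh (sin h)))"
    proof -
      have "arcsin (sin h) = h"
        using \<open>\<bar>u 0\<bar> \<le> pi\<close> by (intro arcsin_sin) (auto simp: h_def)
      then have "2 * arcsin (tanh (artanh (sin h))) = 2 * h"
        by (simp only: tanh_c)
      then show ?thesis
        by (simp add: h_def)
    qed
    show "w 0 = 2 / (\<kappa> * cosh (0 / \<kappa> + artanh (sin h)))"
    proof -
      have "\<kappa> * w 0 * cosh (artanh (sin h)) = 2"
        unfolding w0 using cosh_c by simp
      then show ?thesis
        using \<open>\<kappa> > 0\<close> by (simp add: eq_divide_eq mult_ac)
    qed
  qed (fact \<open>\<kappa> > 0\<close>)+
  then show ?thesis by blast
qed

lemma separatrix_classification:
  assumes u: "pendulum_flow \<kappa> u w" and "\<kappa> > 0"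
    and energy: "1/2 * \<kappa>\<^sup>2 * (w 0)\<^sup>2 = 1 + cos (u 0)" and "\<bar>u 0\<bar> \<le> pi"
  shows "(\<exists>c. \<forall>x. u x = 2 * arcsin (tanh (x / \<kappa> + c))) \<or>
         (\<exists>c. \<forall>x. u x = - 2 * arcsin (tanh (x / \<kappa> + c))) \<or>
         (\<forall>x. u x = pi) \<or> (\<forall>x. u x = - pi)"
proof -
  consider "w 0 > 0" | "w 0 < 0" | "w 0 = 0"
    by linarith
  then show ?thesis
  proof cases
    case 1
    with separatrix_increasing[OF u] assms show ?thesis by blast
  next
    case 2
    with separatrix_increasing[OF pendulum_flow_minus[OF u]] assms
    obtain c where "\<forall>x. - u x = 2 * arcsin (tanh (x / \<kappa> + c))"
      by auto
    then have "\<forall>x. u x = - 2 * arcsin (tanh (x / \<kappa> + c))"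
      by (metis minus_minus mult_minus_left)
    then show ?thesis by blast
  next
    case 3
    with energy have "cos \<bar>u 0\<bar> = cos pi"
      by simp
    with \<open>\<bar>u 0\<bar> \<le> pi\<close> have "\<bar>u 0\<bar> = pi"
      using cos_inj_pi[of "\<bar>u 0\<bar>" pi] by simp
    then have u0: "u 0 = pi \<or> u 0 = - pi"
      by linarith
    then have "sin (u 0) = 0"
      by auto
    then have "pendulum_flow \<kappa> (\<lambda>x. u 0) (\<lambda>x. 0)"
      by (simp add: pendulum_flow_def)
    \<comment> \<open>The solution starts at rest in an unstable equilibrium.\<close>
    from pendulum_flow_unique[OF u this \<open>\<kappa> > 0\<close>, of 0] 3 have "u x = u 0" for x
      by simp
    with u0 show ?thesis by metis
  qed
qed

section \<open>Libration\<close>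

text \<open>The angle cannot cross \<open>pi\<close> or \<open>-pi\<close>, where the cosine is \<open>-1\<close>; inside this interval the
  inverse cosine turns the bound on \<open>cos u\<close> into one on \<open>\<bar>u\<bar>\<close>.\<close>

lemma cos_bound_traps_angle:
  fixes u :: "real \<Rightarrow> real"
  assumes cont: "continuous_on UNIV u" and "\<bar>u 0\<bar> \<le> pi"
    and "-1 < C" "C < 1" and cos_ge: "\<And>x. cos (u x) \<ge> - C"
  shows "\<bar>u x\<bar> \<le> arccos (- C)"
proof -
  have avoid: "\<bar>u y\<bar> \<noteq> pi" for y
  proof
    assume "\<bar>u y\<bar> = pi"
    then have "cos (u y) = -1"
      by (metis cos_abs_real cos_pi)
    with cos_ge[of y] \<open>C < 1\<close> show False by simp
  qed
  have "\<bar>u x\<bar> < pi"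
  proof (rule ccontr)
    assume "\<not> \<bar>u x\<bar> < pi"
    moreover have "connected (range (\<lambda>y. \<bar>u y\<bar>))"
      by (intro connected_continuous_image continuous_intros cont) auto
    ultimately have "pi \<in> range (\<lambda>y. \<bar>u y\<bar>)"
      using \<open>\<bar>u 0\<bar> \<le> pi\<close> connectedD_interval[of _ "\<bar>u 0\<bar>" "\<bar>u x\<bar>" pi] by auto
    then show False
      using avoid by (metis imageE)
  qed
  then have "\<bar>u x\<bar> = arccos (cos \<bar>u x\<bar>)"
    using arccos_cos[of "\<bar>u x\<bar>"] by simp
  also have "\<dots> \<le> arccos (- C)"
    using cos_ge[of x] assms by (intro arccos_le_arccos) auto
  finally show ?thesis .
qed

lemma sin_bounded_below_in_interior:
  assumes "0 < l" and "l \<le> y" and "y \<le> M" and "M < pi"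
  shows "min (sin l) (sin M) \<le> sin (y::real)"
proof (cases "y \<le> pi / 2")
  case True
  then have "sin l \<le> sin y"
    using assms by (intro sin_monotone_2pi_le) auto
  then show ?thesis by simp
next
  case False
  have "sin (pi - M) \<le> sin (pi - y)"
    using assms False by (intro sin_monotone_2pi_le) auto
  then show ?thesis by simp
qed

text \<open>A positive angle below \<open>M < pi\<close> is pulled back by a force bounded away from \<open>0\<close>, which would
  eventually reverse the motion; an angle that stays nonpositive is never decelerated, so it would run
  past \<open>0\<close>.\<close>

lemma trapped_angle_not_increasing:
  assumes u: "pendulum_flow \<kappa> u w" and "\<kappa> > 0" and trap: "\<And>x. \<bar>u x\<bar> \<le> M" and "M < pi"
  shows "\<exists>x\<ge>a. w x \<le> 0"
proof (rule ccontr)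
  assume "\<not> ?thesis"
  then have pos: "w x > 0" if "a \<le> x" for x
    using that by auto
  show False
  proof (cases "\<exists>b\<ge>a. u b > 0")
    case True
    then obtain b where b: "a \<le> b" "u b > 0" by blast
    define d where "d = min (sin (u b)) (sin M)"
    have "M > 0"
      using b trap[of b] by linarith
    then have "d > 0"
      using b trap[of b] \<open>M < pi\<close> by (auto simp: d_def intro!: sin_gt_zero)
    have "d / \<kappa>\<^sup>2 \<le> - (- sin (u x) / \<kappa>\<^sup>2)" if "b \<le> x" for x
    proof -
      have "u b \<le> u x"
        using that b pos pendulum_flowD(1)[OF u]
        by (intro DERIV_nonneg_imp_nondecreasing[OF that]) (meson less_imp_le order_trans)
      then have "d \<le> sin (u x)"
        using sin_bounded_below_in_interior[of "u b" "u x" M] b trap[of x] \<open>M < pi\<close>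
        by (auto simp: d_def)
      then show ?thesis
        by (simp add: divide_right_mono)
    qed
    then obtain x where "x \<ge> b" "- w x > 0"
      using slope_bounded_below_imp_unbounded
        [OF pendulum_flowD(2)[OF u, THEN DERIV_minus], of b "d / \<kappa>\<^sup>2" 0] \<open>d > 0\<close> \<open>\<kappa> > 0\<close>
      by auto
    with pos[of x] b show False by simp
  next
    case False
    have "w a \<le> w x" if "a \<le> x" for x
    proof (rule DERIV_nonneg_imp_nondecreasing[OF that])
      fix t assume "a \<le> t"
      with False have "u t \<le> 0" by (meson not_less)
      then have "sin (- u t) \<ge> 0"
        using trap[of t] \<open>M < pi\<close> by (intro sin_ge_zero) auto
      then have "- sin (u t) / \<kappa>\<^sup>2 \<ge> 0"
        by (intro divide_nonneg_nonneg) auto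
      with pendulum_flowD(2)[OF u] show "\<exists>y. (w has_real_derivative y) (at t) \<and> 0 \<le> y"
        by blast
    qed
    then obtain x where "x \<ge> a" "u x > M"
      using slope_bounded_below_imp_unbounded[OF pendulum_flowD(1)[OF u], of a "w a" M] pos[of a]
      by auto
    with trap[of x] show False by simp
  qed
qed

lemma trapped_velocity_has_zero:
  assumes u: "pendulum_flow \<kappa> u w" and "\<kappa> > 0" and trap: "\<And>x. \<bar>u x\<bar> \<le> M" and "M < pi"
  shows "\<exists>x\<ge>a. w x = 0"
proof (rule ccontr)
  assume "\<not> ?thesis"
  then consider "\<forall>x\<ge>a. w x > 0" | "\<forall>x\<ge>a. w x < 0"
    using nonvanishing_imp_constant_sign[of a w] pendulum_flow_continuous[OF u] by blast
  then show False
  proof cases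
    case 1
    then show False
      using trapped_angle_not_increasing[OF u \<open>\<kappa> > 0\<close> trap \<open>M < pi\<close>] by (meson not_less)
  next
    case 2
    have "\<exists>x\<ge>a. - w x \<le> 0"
      using pendulum_flow_minus[OF u] \<open>\<kappa> > 0\<close> _ \<open>M < pi\<close>
      by (rule trapped_angle_not_increasing) (simp add: trap)
    with 2 show False by fastforce
  qed
qed

text \<open>The composition of the reflections in two zeros of the velocity is a translation.\<close>

lemma trapped_periodic:
  assumes u: "pendulum_flow \<kappa> u w" and "\<kappa> > 0" and trap: "\<And>x. \<bar>u x\<bar> \<le> M" and "M < pi"
  shows "periodic u"
proof -
  obtain a where a: "w a = 0"
    using trapped_velocity_has_zero[OF assms, of 0] by blast
  obtain b where b: "b \<ge> a + 1" "w b = 0"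
    using trapped_velocity_has_zero[OF assms, of "a + 1"] by blast
  have "u (x + 2 * (b - a)) = u x" for x
  proof -
    have "u (x + 2 * (b - a)) = u (2 * b - (2 * a - x))"
      by (simp add: algebra_simps)
    also have "\<dots> = u (2 * a - x)"
      by (rule pendulum_flow_symmetric_about_rest[OF u \<open>\<kappa> > 0\<close> b(2)])
    also have "\<dots> = u x"
      by (rule pendulum_flow_symmetric_about_rest[OF u \<open>\<kappa> > 0\<close> a])
    finally show ?thesis .
  qed
  then have "periodic_fun_simple u (2 * (b - a))"
    by unfold_locales
  moreover have "2 * (b - a) > 0"
    using b by simp
  ultimately show ?thesis
    unfolding periodic_def by blast
qed

section \<open>The classification\<close>

lemma minimal_energy_imp_zero:
  assumes u: "pendulum_flow \<kappa> u w" and "\<kappa> > 0"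
    and energy: "\<And>x. 1/2 * \<kappa>\<^sup>2 * (w x)\<^sup>2 = -1 + cos (u x)" and "\<bar>u 0\<bar> \<le> pi"
  shows "u x = 0"
proof -
  have sq: "1/2 * \<kappa>\<^sup>2 * (w y)\<^sup>2 = 0" for y
  proof (rule antisym)
    show "1/2 * \<kappa>\<^sup>2 * (w y)\<^sup>2 \<le> 0"
      unfolding energy by simp
  qed simp
  then have w: "w y = 0" for y
    using \<open>\<kappa> > 0\<close> by simp
  have "cos \<bar>u 0\<bar> = cos 0"
    using energy[of 0] sq[of 0] by simp
  then have "u 0 = 0"
    using \<open>\<bar>u 0\<bar> \<le> pi\<close> cos_inj_pi[of "\<bar>u 0\<bar>" 0] by simp
  moreover have "u x = u 0"
    using pendulum_flowD(1)[OF u] by (intro DERIV_isconst_all) (simp add: w)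
  ultimately show ?thesis by simp
qed

theorem proposition3p2:
  fixes \<kappa> C :: real
  assumes "\<kappa> > 0" and "C \<ge> -1"
  shows
    "(C > 1 \<longrightarrow>
        \<not> (\<exists>u. pendulum_solution \<kappa> u \<and> bounded (range u) \<and> first_integral_const \<kappa> u C)) \<and>
     (\<forall>u. pendulum_solution \<kappa> u \<and> bounded (range u) \<and> \<bar>u 0\<bar> \<le> pi \<and>
          first_integral_const \<kappa> u C \<longrightarrow>
        (C = -1 \<longrightarrow> (\<forall>x. u x = 0)) \<and>
        (C = 1 \<longrightarrow>
           (\<exists>c. \<forall>x. u x = 2 * arcsin (tanh (x / \<kappa> + c))) \<or>
           (\<exists>c. \<forall>x. u x = - 2 * arcsin (tanh (x / \<kappa> + c))) \<or>
           (\<forall>x. u x = pi) \<or>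
           (\<forall>x. u x = - pi)) \<and>
        (-1 < C \<and> C < 1 \<longrightarrow> periodic u \<and> sup_norm u < pi))"
proof (intro conjI allI impI)
  show "\<not> (\<exists>u. pendulum_solution \<kappa> u \<and> bounded (range u) \<and> first_integral_const \<kappa> u C)"
    if "C > 1"
  proof
    assume "\<exists>u. pendulum_solution \<kappa> u \<and> bounded (range u) \<and> first_integral_const \<kappa> u C"
    then obtain u where u: "pendulum_solution \<kappa> u" "bounded (range u)" "first_integral_const \<kappa> u C"
      by blast
    have "\<not> bounded (range u)"
      using pendulum_solution_imp_flow[OF u(1) \<open>\<kappa> > 0\<close>] \<open>\<kappa> > 0\<close> \<open>C > 1\<close>
        u(3)[unfolded first_integral_const_def, rule_format]
      by (rule rotation_unbounded)
    with u(2) show False by blast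
  qed
next
  fix u
  assume sol: "pendulum_solution \<kappa> u \<and> bounded (range u) \<and> \<bar>u 0\<bar> \<le> pi \<and> first_integral_const \<kappa> u C"
  have flow: "pendulum_flow \<kappa> u (deriv u)"
    using sol \<open>\<kappa> > 0\<close> by (blast intro: pendulum_solution_imp_flow)
  have energy: "1/2 * \<kappa>\<^sup>2 * (deriv u x)\<^sup>2 = C + cos (u x)" for x
    using sol unfolding first_integral_const_def by blast
  have u0: "\<bar>u 0\<bar> \<le> pi"
    using sol by blast
  show "u x = 0" if "C = -1" for x
    using minimal_energy_imp_zero[OF flow \<open>\<kappa> > 0\<close> energy[unfolded that] u0] .
  show "(\<exists>c. \<forall>x. u x = 2 * arcsin (tanh (x / \<kappa> + c))) \<or>
    (\<exists>c. \<forall>x. u x = - 2 * arcsin (tanh (x / \<kappa> + c))) \<or> (\<forall>x. u x = pi) \<or> (\<forall>x. u x = - pi)"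
    if "C = 1"
    using separatrix_classification[OF flow \<open>\<kappa> > 0\<close> energy[unfolded that] u0] .
  assume C: "-1 < C \<and> C < 1"
  have "cos (u x) \<ge> - C" for x
  proof -
    have "0 \<le> 1/2 * \<kappa>\<^sup>2 * (deriv u x)\<^sup>2"
      by simp
    then show ?thesis
      unfolding energy by simp
  qed
  then have trap: "\<bar>u x\<bar> \<le> arccos (- C)" for x
    using cos_bound_traps_angle[OF pendulum_flow_continuous(1)[OF flow] u0] C by blast
  have "arccos (- C) < pi"
    using arccos_less_arccos[of "-1" "- C"] C by simp
  with trap show "periodic u"
    by (rule trapped_periodic[OF flow \<open>\<kappa> > 0\<close>])
  have "sup_norm u \<le> arccos (- C)"
    unfolding sup_norm_def using trap by (intro cSUP_least) auto
  with \<open>arccos (- C) < pi\<close> show "sup_norm u < pi"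
    by simp
qed

end
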